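(* Let $\lambda,x,y$ be indeterminates, and let $\{Q_n\}_{n\ge 0}$ be the sequence of polynomials in $\lambda,x,y$ defined by $Q_0=1$ and, for $n\ge 1$, $$Q_n=\binom{\lambda}{n}(-1)^n-x\sum_{k=1}^n(-1)^k\binom{y}{k}Q_{n-k}.$$ Then for every integer $n\ge 0$, as an identity of formal power series in $x$ (with coefficients in $\mathbb{Q}[\lambda,y]$), $$Q_n=\sum_{k=0}^\infty(-1)^{n+k}\binom{\lambda+ky}{n}\frac{x^k}{(1-x)^{k+1}}.$$
   Context: For an indeterminate or polynomial $u$ and integer $n\ge 0$, $\binom{u}{n}=\frac{u(u-1)\cdots(u-n+1)}{n!}$ (equal to $1$ for $n=0$). The fraction $\frac{x^k}{(1-x)^{k+1}}$ is understood as the formal power series $\sum_{j\ge 0}\binom{k+j}{j}x^{k+j}$, so that the infinite sum over $k$ is well defined in the ring of formal power series in $x$. *)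

theory Defs
  imports "HOL-Computational_Algebra.Computational_Algebra"
begin

text \<open>
  The ring of polynomials in \<open>\<lambda>, y\<close> over the rationals is rendered as \<^typ>\<open>rat poly poly\<close>
  (inner variable \<open>\<lambda>\<close>, outer variable \<open>y\<close>); polynomials in \<open>\<lambda>, x, y\<close> are polynomials in \<open>x\<close>
  with coefficients in that ring.
\<close>

type_synonym coeff = "rat poly poly"

definition lam :: coeff where
  "lam = [:[:0, 1:]:]"

definition yy :: coeff where
  "yy = [:0, 1:]"

definition xx :: "coeff poly" where
  "xx = [:0, 1:]"

text \<open>
  The library's \<^const>\<open>gbinomial\<close> is restricted to fields of characteristic 0, which
  \<^typ>\<open>coeff\<close> is not; \<^term>\<open>[:[:c:]:] :: coeff\<close> is the rational constant \<open>c\<close>.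
\<close>

definition binom :: "coeff \<Rightarrow> nat \<Rightarrow> coeff" where
  "binom u n = [:[:1 / fact n:]:] * (\<Prod>i = 0..<n. u - of_nat i)"

lemma fact_mult_binom: "fact n * binom u n = (\<Prod>i = 0..<n. u - of_nat i)"
proof -
  have "(fact n :: coeff) = of_nat (fact n)"
    by (rule of_nat_fact[symmetric])
  also have "\<dots> = [:[:fact n:]:]"
    by (simp only: of_nat_poly of_nat_fact)
  finally have "(fact n :: coeff) * [:[:1 / fact n:]:] = 1"
    by (simp add: one_pCons)
  then show ?thesis
    unfolding binom_def mult.assoc[symmetric] by simp
qed

lemma binom_const: "binom [:[:c:]:] n = [:[:c gchoose n:]:]"
proof -
  have "(\<Prod>i = 0..<n. [:[:c:]:] - of_nat i) = ([:[:\<Prod>i = 0..<n. c - of_nat i:]:] :: coeff)"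
    by (induction n) (simp_all add: one_pCons of_nat_poly mult.commute)
  then show ?thesis
    by (simp add: binom_def gbinomial_prod_rev)
qed

fun Q :: "nat \<Rightarrow> coeff poly" where
  "Q n = (if n = 0 then 1
          else [:binom lam n:] * (-1) ^ n
               - xx * (\<Sum>k = 1..n. (-1) ^ k * [:binom yy k:] * Q (n - k)))"

declare Q.simps [simp del]

text \<open>
  The power series meant by \<open>x\<^sup>k / (1 - x)\<^sup>k\<^sup>+\<^sup>1\<close>. Infinite sums of formal power series refer
  to the library's metric on \<^typ>\<open>'a fps\<close>, which induces the \<open>x\<close>-adic topology.
\<close>

definition frac_series :: "nat \<Rightarrow> coeff fps" where
  "frac_series k = (\<Sum>j. of_nat ((k + j) choose j) * fps_X ^ (k + j))"

lemma frac_series_sums: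
  "(\<lambda>j. of_nat ((k + j) choose j) * fps_X ^ (k + j)) sums
     (Abs_fps (\<lambda>m. if k \<le> m then of_nat (m choose k) else 0) :: coeff fps)"
    (is "?f sums ?S")
  unfolding sums_def
proof (rule tendsto_fpsI)
  fix m :: nat
  have nth: "fps_nth (?f j) m = (if m = k + j then of_nat (m choose k) else 0)" for j
  proof -
    have "?f j = fps_const (of_nat ((k + j) choose k)) * fps_X ^ (k + j)"
      using binomial_symmetric[of j "k + j"] by (simp add: fps_of_nat)
    then show ?thesis
      by (simp only: fps_mult_left_const_nth fps_X_power_nth) simp
  qed
  have "fps_nth (\<Sum>j<N. ?f j) m = fps_nth ?S m" if "N > m" for N
  proof (cases "k \<le> m")
    case True
    then have "(\<Sum>j<N. fps_nth (?f j) m)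
        = (\<Sum>j<N. if j = m - k then of_nat (m choose k) else 0)"
      unfolding nth by (intro sum.cong) auto
    then show ?thesis using True that by (simp add: fps_sum_nth)
  next
    case False
    then show ?thesis by (simp add: fps_sum_nth nth)
  qed
  then show "\<forall>\<^sub>F N in sequentially. fps_nth (\<Sum>j<N. ?f j) m = fps_nth ?S m"
    by (intro eventually_sequentiallyI[of "Suc m"]) simp
qed

lemma frac_series_nth:
  "fps_nth (frac_series k) m = (if k \<le> m then of_nat (m choose k) else 0)"
  unfolding frac_series_def sums_unique[OF frac_series_sums, symmetric] by simp

lemma frac_series_0: "(1 - fps_X) * frac_series 0 = 1"
  by (rule fps_ext) (auto simp: algebra_simps frac_series_nth fps_X_mult_nth)

lemma frac_series_Suc: "(1 - fps_X) * frac_series (Suc k) = fps_X * frac_series k"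
proof (rule fps_ext)
  fix m
  show "fps_nth ((1 - fps_X) * frac_series (Suc k)) m = fps_nth (fps_X * frac_series k) m"
    by (cases m) (auto simp: algebra_simps frac_series_nth fps_X_mult_nth not_le)
qed

lemma frac_series_quotient: "(1 - fps_X) ^ (k + 1) * frac_series k = fps_X ^ k"
proof (induction k)
  case (Suc k)
  have "(1 - fps_X) ^ (Suc k + 1) * frac_series (Suc k)
      = (1 - fps_X) ^ (k + 1) * ((1 - fps_X) * frac_series (Suc k))"
    by (simp add: mult_ac)
  also have "\<dots> = fps_X * ((1 - fps_X) ^ (k + 1) * frac_series k)"
    unfolding frac_series_Suc by (simp only: mult_ac)
  finally show ?case
    by (simp only: Suc.IH power_Suc)
qed (simp add: frac_series_0)

end

theory Submission
  imports Defs
begin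

text \<open>
  Both sides satisfy the same recursion. The coefficient of \<open>x\<^sup>m\<close> in \<open>x\<^sup>k / (1 - x)\<^sup>k\<^sup>+\<^sup>1\<close> is
  \<open>m choose k\<close>, so the coefficient of \<open>x\<^sup>m\<close> on the right-hand side is the finite sum
  \<open>(-1)\<^sup>n \<Sum>\<^sub>k (-1)\<^sup>k (m choose k) binom (\<lambda> + k y) n\<close>. Up to sign this is the \<open>m\<close>-th finite
  difference at \<open>0\<close> of the function \<open>k \<mapsto> binom (\<lambda> + k y) n\<close>. Vandermonde's convolution expands
  one difference step,
  \<open>binom (\<lambda> + (k + 1) y) n - binom (\<lambda> + k y) n = \<Sum>\<^sub>i binom y i * binom (\<lambda> + k y) (n - i)\<close>
  with \<open>i\<close> from \<open>1\<close> to \<open>n\<close>, and so expresses the coefficient of \<open>x\<^sup>m\<^sup>+\<^sup>1\<close> for \<open>n\<close> through the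
  coefficients of \<open>x\<^sup>m\<close> for \<open>n - i\<close>. This is the recursion that defines \<open>Q\<close>: the factor \<open>x\<close> in
  it accounts for the shift from \<open>m\<close> to \<open>m + 1\<close>. For \<open>m = 0\<close> only \<open>(-1)\<^sup>n binom \<lambda> n\<close> is
  left, which is the inhomogeneous term.
\<close>

lemma binom_0 [simp]: "binom u 0 = 1"
  by (simp add: binom_def one_pCons)

lemma fact_mult_binom_pochhammer: "fact n * binom u n = (-1) ^ n * pochhammer (- u) n"
proof -
  have "(\<Prod>i = 0..<n. u - of_nat i) = (\<Prod>i = 0..<n. (-1) * (- u + of_nat i))"
    by (intro prod.cong) auto
  also have "\<dots> = (-1) ^ n * pochhammer (- u) n"
    unfolding prod.distrib pochhammer_prod by simp
  finally show ?thesis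
    by (simp add: fact_mult_binom)
qed

text \<open>
  Vandermonde's convolution. Multiplied by \<open>fact n\<close>, which can be cancelled in an integral domain
  of characteristic 0, it becomes the binomial theorem for rising factorials.
\<close>

lemma binom_add: "binom (u + v) n = (\<Sum>k\<le>n. binom u k * binom v (n - k))"
proof -
  have "fact n * binom (u + v) n = (-1) ^ n * pochhammer (- u + - v) n"
    by (simp add: fact_mult_binom_pochhammer)
  also have "\<dots> = (\<Sum>k\<le>n. of_nat (n choose k) * ((-1) ^ k * pochhammer (- u) k)
                          * ((-1) ^ (n - k) * pochhammer (- v) (n - k)))"
    unfolding pochhammer_binomial_sum sum_distrib_left
  proof (intro sum.cong refl)
    fix k assume "k \<in> {..n}"
    then have "(-1 :: coeff) ^ n = (-1) ^ k * (-1) ^ (n - k)"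
      by (simp flip: power_add)
    then show "(-1) ^ n * (of_nat (n choose k) * pochhammer (- u) k * pochhammer (- v) (n - k))
        = of_nat (n choose k) * ((-1) ^ k * pochhammer (- u) k)
            * ((-1) ^ (n - k) * pochhammer (- v) (n - k))"
      by (simp only: mult_ac)
  qed
  also have "\<dots> = (\<Sum>k\<le>n. fact n * (binom u k * binom v (n - k)))"
  proof (intro sum.cong refl)
    fix k assume "k \<in> {..n}"
    then have "fact k * fact (n - k) * (n choose k) = (fact n :: nat)"
      by (simp add: binomial_fact_lemma)
    then have "of_nat (fact k * fact (n - k) * (n choose k)) = (of_nat (fact n) :: coeff)"
      by (rule arg_cong)
    then have fact_n: "fact n = fact k * fact (n - k) * (of_nat (n choose k) :: coeff)"
      by (simp only: of_nat_mult of_nat_fact)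
    show "of_nat (n choose k) * ((-1) ^ k * pochhammer (- u) k)
            * ((-1) ^ (n - k) * pochhammer (- v) (n - k))
        = fact n * (binom u k * binom v (n - k))"
      unfolding fact_mult_binom_pochhammer[symmetric] fact_n by (simp only: mult_ac)
  qed
  also have "\<dots> = fact n * (\<Sum>k\<le>n. binom u k * binom v (n - k))"
    by (rule sum_distrib_left[symmetric])
  finally show ?thesis
    by simp
qed

text \<open>
  Pascal's rule splits off one difference step of an \<open>m\<close>-fold finite difference.
\<close>

lemma alternating_binomial_sum_Suc:
  fixes f :: "nat \<Rightarrow> 'a :: comm_ring_1"
  shows "(\<Sum>k\<le>Suc m. (-1) ^ k * of_nat (Suc m choose k) * f k)
       = (\<Sum>k\<le>m. (-1) ^ k * of_nat (m choose k) * (f k - f (Suc k)))"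
proof -
  have "(\<Sum>k\<le>m. (-1) ^ k * of_nat (m choose k) * f k)
      = (\<Sum>k\<le>Suc m. (-1) ^ k * of_nat (m choose k) * f k)"
    by (simp add: binomial_eq_0)
  also have "\<dots> = f 0 - (\<Sum>k\<le>m. (-1) ^ k * of_nat (m choose Suc k) * f (Suc k))"
    by (subst sum.atMost_Suc_shift) (simp add: sum_negf)
  finally have split: "(\<Sum>k\<le>m. (-1) ^ k * of_nat (m choose k) * f k)
      = f 0 - (\<Sum>k\<le>m. (-1) ^ k * of_nat (m choose Suc k) * f (Suc k))" .
  have "(\<Sum>k\<le>Suc m. (-1) ^ k * of_nat (Suc m choose k) * f k)
      = f 0 - (\<Sum>k\<le>m. (-1) ^ k * of_nat (m choose Suc k) * f (Suc k))
            - (\<Sum>k\<le>m. (-1) ^ k * of_nat (m choose k) * f (Suc k))"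
    by (subst sum.atMost_Suc_shift)
       (simp add: distrib_left distrib_right left_diff_distrib sum.distrib sum_subtractf sum_negf)
  then show ?thesis
    by (simp only: split[symmetric] right_diff_distrib sum_subtractf)
qed

text \<open>
  The coefficient of \<open>x\<^sup>m\<close> in the claimed expansion of \<open>Q n\<close>. The sum stops at \<open>k = m\<close> because
  \<open>x\<^sup>k / (1 - x)\<^sup>k\<^sup>+\<^sup>1\<close> has no terms below \<open>x\<^sup>k\<close>.
\<close>

definition rhs_coeff :: "nat \<Rightarrow> nat \<Rightarrow> coeff" where
  "rhs_coeff n m =
     (-1) ^ n * (\<Sum>k\<le>m. (-1) ^ k * of_nat (m choose k) * binom (lam + of_nat k * yy) n)"

lemma rhs_coeff_0: "rhs_coeff n 0 = (-1) ^ n * binom lam n"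
  by (simp add: rhs_coeff_def)

text \<open>
  The recursion of \<open>Q\<close> on the level of coefficients. One difference step in \<open>k\<close> adds \<open>y\<close> to
  \<open>\<lambda> + k y\<close>; Vandermonde's convolution expands the result, and its term \<open>i = 0\<close> is the value
  that the difference subtracts.
\<close>

lemma rhs_coeff_Suc:
  "rhs_coeff n (Suc m) = - (\<Sum>i = 1..n. (-1) ^ i * binom yy i * rhs_coeff (n - i) m)"
proof -
  define b where "b k = binom (lam + of_nat k * yy)" for k
  have step: "b k n - b (Suc k) n = - (\<Sum>i = 1..n. binom yy i * b k (n - i))" for k
  proof -
    have "b (Suc k) n = binom (yy + (lam + of_nat k * yy)) n"
      unfolding b_def by (simp add: algebra_simps)
    also have "\<dots> = (\<Sum>i\<le>n. binom yy i * b k (n - i))"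
      unfolding b_def by (rule binom_add)
    also have "\<dots> = b k n + (\<Sum>i = 1..n. binom yy i * b k (n - i))"
      by (simp add: sum.atLeast_Suc_atMost atMost_atLeast0)
    finally show ?thesis
      by simp
  qed
  have "rhs_coeff n (Suc m)
      = (-1) ^ n * (\<Sum>k\<le>m. (-1) ^ k * of_nat (m choose k) * (b k n - b (Suc k) n))"
    unfolding rhs_coeff_def b_def alternating_binomial_sum_Suc ..
  also have "\<dots> = - (\<Sum>k\<le>m. \<Sum>i = 1..n.
                  (-1) ^ n * ((-1) ^ k * of_nat (m choose k) * (binom yy i * b k (n - i))))"
    unfolding step by (simp add: sum_distrib_left sum_negf)
  also have "\<dots> = - (\<Sum>i = 1..n. \<Sum>k\<le>m.
                  (-1) ^ n * ((-1) ^ k * of_nat (m choose k) * (binom yy i * b k (n - i))))"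
    by (subst sum.swap) (rule refl)
  also have "\<dots> = - (\<Sum>i = 1..n. (-1) ^ i * binom yy i * rhs_coeff (n - i) m)"
    unfolding rhs_coeff_def b_def[symmetric] sum_distrib_left
  proof (intro arg_cong[where f = uminus] sum.cong refl)
    fix i k assume "i \<in> {1..n}"
    then have "(-1 :: coeff) ^ n = (-1) ^ i * (-1) ^ (n - i)"
      by (simp flip: power_add)
    then show "(-1) ^ n * ((-1) ^ k * of_nat (m choose k) * (binom yy i * b k (n - i)))
        = (-1) ^ i * binom yy i * ((-1) ^ (n - i) * ((-1) ^ k * of_nat (m choose k) * b k (n - i)))"
      by (simp only: mult_ac)
  qed
  finally show ?thesis .
qed

lemma coeff_Q_eq_rhs_coeff: "coeff (Q n) m = rhs_coeff n m"
proof (induction n arbitrary: m rule: less_induct)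
  case (less n)
  have sign: "((-1) ^ i :: coeff poly) = [:(-1) ^ i:]" for i
    by (induction i) (simp_all add: one_pCons)
  show ?case
  proof (cases "n = 0")
    case True
    then show ?thesis
      by (cases m) (simp_all add: Q.simps[of 0] rhs_coeff_0 rhs_coeff_Suc)
  next
    case False
    then have "Q n = [:(-1) ^ n * binom lam n:]
        - pCons 0 (\<Sum>i = 1..n. smult ((-1) ^ i * binom yy i) (Q (n - i)))"
      by (subst Q.simps) (simp add: xx_def sign mult.commute)
    moreover have "coeff (Q (n - i)) m' = rhs_coeff (n - i) m'" if "i \<in> {1..n}" for i m'
      using that less.IH[of "n - i"] by auto
    ultimately show ?thesis
      by (cases m) (simp_all add: rhs_coeff_0 rhs_coeff_Suc coeff_sum)
  qed
qed

theorem proposition2: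
  fixes n :: nat
  shows "(\<lambda>k. (-1) ^ (n + k) * fps_const (binom (lam + of_nat k * yy) n) * frac_series k)
           sums fps_of_poly (Q n)"
  (is "?f sums _")
  unfolding sums_def
proof (rule tendsto_fpsI)
  fix m :: nat
  have sign: "((-1) ^ i :: coeff fps) = fps_const ((-1) ^ i)" for i
  proof -
    have "(-1 :: coeff fps) = fps_const (-1)"
      by (metis fps_const_neg fps_const_1_eq_1)
    then show ?thesis
      by (simp only: fps_const_power)
  qed
  have nth: "fps_nth (?f k) m
      = (if k \<le> m then (-1) ^ n * ((-1) ^ k * of_nat (m choose k) * binom (lam + of_nat k * yy) n)
         else 0)" for k
    unfolding sign fps_const_mult fps_mult_left_const_nth frac_series_nth
    by (simp add: power_add mult_ac)
  have "fps_nth (\<Sum>k<N. ?f k) m = fps_nth (fps_of_poly (Q n)) m" if "N > m" for N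
  proof -
    have "fps_nth (\<Sum>k<N. ?f k) m = (\<Sum>k\<le>m. fps_nth (?f k) m)"
      unfolding fps_sum_nth using that by (intro sum.mono_neutral_right) (auto simp: nth)
    also have "\<dots> = rhs_coeff n m"
      unfolding rhs_coeff_def sum_distrib_left by (intro sum.cong) (auto simp: nth)
    finally show ?thesis
      by (simp add: coeff_Q_eq_rhs_coeff)
  qed
  then show "\<forall>\<^sub>F N in sequentially. fps_nth (\<Sum>k<N. ?f k) m = fps_nth (fps_of_poly (Q n)) m"
    by (intro eventually_sequentiallyI[of "Suc m"]) simp
qed

end
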